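(* Let $D,n\ge 3$ be integers, let $x$ be a vertex of the Hamming graph $H(D,n)$, and let $A$ be the adjacency matrix of the full bipartite graph $H(D,n)_f(x)$ of $H(D,n)$ with respect to $x$. For $0\le i\le 2D$, the multiplicity $m_i$ of the eigenvalue $\theta_i=\sqrt{n-1}\,(D-i)$ of $A$ is $$m_i=\sum_{\substack{|D-i|\le d\le D\\ d-D+i\ \text{even}}}\ \sum_{0\le r\le D-d}\mathrm{mult}(r,d),$$ where, for integers $r,d$ with $0\le r\le r+d\le D\le 2r+d$, $$\mathrm{mult}(r,d)=\frac{d+1}{D-r+1}\binom{D}{2D-2r-d}\binom{2D-2r-d}{D-r-d}(n-2)^{2r+d-D},$$ and $\mathrm{mult}(r,d)=0$ if $2r+d<D$.
   Context: Hamming graph: let $S$ be a set with $n$ elements. $H(D,n)$ has vertex set $X=S^D$, and two vertices are adjacent iff they differ in precisely one coordinate. $\partial$ denotes path-length distance in $H(D,n)$ (the Hamming distance). Full bipartite graph: given a connected graph with vertex set $X$, edge set $\mathcal{E}$, distance $\partial$, and a vertex $x$, its full bipartite graph with respect to $x$ is the graph $(X,\mathcal{E}_f)$ with $\mathcal{E}_f=\mathcal{E}\setminus\{yz \mid \partial(x,y)=\partial(x,z)\}$. The adjacency matrix is the usual real $0/1$ matrix with rows and columns indexed by $X$. The multiplicity of an eigenvalue is the dimension of its eigenspace in $\mathbb{R}^X$. In the sums, $d$ and $r$ are integers. *)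

theory Defs
  imports "HOL-Analysis.Analysis"
begin

text \<open>A finite simple graph is given by its edge set, a set of two-element subsets of the
  vertex type; the vertex set is the whole type. The vertex set \<open>S\<^sup>D\<close> of a Hamming graph is
  the type \<open>'s ^ 'd\<close>, where \<open>CARD('s) = n\<close> and \<open>CARD('d) = D\<close>.\<close>

definition hamming_edges :: "('s ^ 'd) set set" where
  "hamming_edges = {{y, z} | y z. card {k. y $ k \<noteq> z $ k} = 1}"

text \<open>Length of a shortest walk; meaningful only if \<open>v\<close> is reachable from \<open>u\<close>,
  in particular in connected graphs.\<close>

definition graph_dist :: "'v set set \<Rightarrow> 'v \<Rightarrow> 'v \<Rightarrow> nat" where
  "graph_dist E u v = (LEAST k. (u, v) \<in> {(a, b). {a, b} \<in> E} ^^ k)"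

definition full_bipartite_edges :: "'v set set \<Rightarrow> 'v \<Rightarrow> 'v set set" where
  "full_bipartite_edges E x = E - {{y, z} | y z. graph_dist E x y = graph_dist E x z}"

definition adjacency_matrix :: "'v set set \<Rightarrow> real ^ 'v ^ 'v" where
  "adjacency_matrix E = (\<chi> y z. if {y, z} \<in> E then 1 else 0)"

definition eigenspace :: "real ^ 'v ^ 'v \<Rightarrow> real \<Rightarrow> (real ^ 'v) set" where
  "eigenspace A \<theta> = {v. A *v v = \<theta> *\<^sub>R v}"

definition multiplicity_of :: "real ^ 'v ^ 'v \<Rightarrow> real \<Rightarrow> nat" where
  "multiplicity_of A \<theta> = dim (eigenspace A \<theta>)"

text \<open>Used only for \<open>0 \<le> r\<close>, \<open>0 \<le> d\<close> and \<open>r + d \<le> D\<close>. There, in the second branch,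
  every argument of \<open>nat\<close> is nonnegative.\<close>

definition mult_rd :: "nat \<Rightarrow> nat \<Rightarrow> int \<Rightarrow> int \<Rightarrow> real" where
  "mult_rd D n r d =
    (if 2 * r + d < int D then 0
     else of_int (d + 1) / of_int (int D - r + 1)
       * of_nat (D choose nat (2 * int D - 2 * r - d))
       * of_nat (nat (2 * int D - 2 * r - d) choose nat (int D - r - d))
       * (real n - 2) ^ nat (2 * r + d - int D))"

end

theory Submission
  imports Defs "HOL-Computational_Algebra.Polynomial"
begin

text \<open>
  An edge of the Hamming graph changes one coordinate, and it survives in the full bipartite graph
  iff it changes the distance to \<open>x\<close>, that is, iff exactly one of its ends agrees with \<open>x\<close> in that
  coordinate (\<open>full_bipartite_hamming_edge_iff\<close>). Hence the full bipartite graph is the Cartesian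
  product of \<open>D\<close> stars \<open>K\<^bsub>1,n-1\<^esub>\<close>, the star of coordinate \<open>k\<close> having its centre at \<open>x $ k\<close>.

  A star has the eigenvalues \<open>\<rho>\<close>, \<open>0\<close>, \<open>- \<rho>\<close> with \<open>\<rho> = sqrt (n - 1)\<close> and multiplicities
  \<open>1\<close>, \<open>n - 2\<close>, \<open>1\<close>. Written as \<open>\<rho> * (1 - e)\<close> with \<open>e \<in> {0, 1, 2}\<close>, they have the generating
  polynomial \<open>1 + (n - 2) * t + t\<^sup>2\<close>. In a Cartesian product, products of eigenvectors are eigenvectors
  and their eigenvalues add up, so orthogonal eigenbases of the stars give an orthogonal eigenbasis of
  the whole graph. The exponents \<open>e\<close> add up too, and the multiplicity of \<open>\<rho> * (D - i)\<close> is the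
  coefficient of \<open>t ^ i\<close> in \<open>(1 + (n - 2) * t + t\<^sup>2) ^ D\<close> (\<open>multiplicity_eq_coeff\<close>).

  It remains to recognise this trinomial coefficient in the double sum. Let \<open>c = 2 * r + d - D\<close>,
  \<open>e = D - c\<close> and \<open>j = D - r - d\<close>. Then the summand is \<open>(D choose c) * (n - 2) ^ c\<close> times
  \<open>(e - 2 * j + 1) / (e - j + 1) * (e choose j)\<close>, which is the ballot number
  \<open>(e choose j) - (e choose (j - 1))\<close>. For fixed \<open>c\<close> the sum over \<open>j\<close> telescopes to a single
  binomial coefficient, and the remaining sum over \<open>c\<close> is the binomial expansion of the
  trinomial power with respect to its middle term (\<open>mult_rd_sum_eq\<close>).
\<close>

section \<open>Multiplicities from an orthogonal eigenbasis\<close>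

text \<open>
  Expanding an eigenvector in the basis and comparing coefficients shows that only basis vectors
  with its own eigenvalue occur, so these form a basis of the eigenspace. The basis is
  indexed by the coordinates themselves, which makes it large enough to span.
\<close>

lemma dim_eigenspace_orthogonal_eigenbasis:
  fixes A :: "real ^ 'v ^ 'v" and w :: "'v::finite \<Rightarrow> real ^ 'v"
  assumes orth: "\<And>f g. f \<noteq> g \<Longrightarrow> w f \<bullet> w g = 0" and nz: "\<And>f. w f \<noteq> 0"
    and eig: "\<And>f. A *v w f = \<mu> f *\<^sub>R w f"
  shows "dim (eigenspace A \<theta>) = card {f. \<mu> f = \<theta>}"
proof -
  have inj: "inj w"
    by (metis injI inner_eq_zero_iff nz orth)
  have ind: "independent (range w)"
    by (rule pairwise_orthogonal_independent)
       (auto simp: pairwise_def orthogonal_def nz orth, metis orth)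
  have "dim (range w) = CARD('v)"
    using dim_eq_card_independent[OF ind] card_image[OF inj] by simp
  then have full: "span (range w) = UNIV"
    using dim_eq_full[of "range w"] by simp
  have expand: "\<exists>c. v = (\<Sum>f\<in>UNIV. c f *\<^sub>R w f)" for v
  proof -
    have "v \<in> span (range w)" by (simp add: full)
    then obtain c where "v = (\<Sum>y\<in>range w. c y *\<^sub>R y)"
      unfolding span_finite[OF finite_imageI[OF finite]] by auto
    then show ?thesis
      by (intro exI[of _ "c \<circ> w"]) (simp add: sum.reindex[OF inj])
  qed
  have "eigenspace A \<theta> = span (w ` {f. \<mu> f = \<theta>})"
  proof
    show "eigenspace A \<theta> \<subseteq> span (w ` {f. \<mu> f = \<theta>})"
    proof
      fix v assume "v \<in> eigenspace A \<theta>"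
      then have v: "A *v v = \<theta> *\<^sub>R v" by (simp add: eigenspace_def)
      obtain c where c: "v = (\<Sum>f\<in>UNIV. c f *\<^sub>R w f)" using expand by blast
      have "A *v v = (\<Sum>f\<in>UNIV. (c f * \<mu> f) *\<^sub>R w f)"
        unfolding c by (simp add: matrix_vector_mult_scaleR eig
            linear_sum[OF matrix_vector_mul_linear])
      then have z: "(\<Sum>f\<in>UNIV. (c f * (\<mu> f - \<theta>)) *\<^sub>R w f) = 0"
        using v unfolding c
        by (simp add: algebra_simps scaleR_sum_right sum_subtractf)
      have "c g = 0" if "\<mu> g \<noteq> \<theta>" for g
      proof -
        have "0 = (\<Sum>f\<in>UNIV. (c f * (\<mu> f - \<theta>)) *\<^sub>R w f) \<bullet> w g" by (simp add: z)
        also have "\<dots> = (\<Sum>f\<in>UNIV. if f = g then (c f * (\<mu> f - \<theta>)) * (w f \<bullet> w g) else 0)"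
          unfolding inner_sum_left by (intro sum.cong refl) (auto simp: orth)
        also have "\<dots> = (c g * (\<mu> g - \<theta>)) * (w g \<bullet> w g)" by simp
        finally show ?thesis using that nz by simp
      qed
      then have "v = (\<Sum>f\<in>{f. \<mu> f = \<theta>}. c f *\<^sub>R w f)"
        unfolding c by (intro sum.mono_neutral_right) auto
      also have "\<dots> \<in> span (w ` {f. \<mu> f = \<theta>})"
        by (intro span_sum span_scale span_base) auto
      finally show "v \<in> span (w ` {f. \<mu> f = \<theta>})" .
    qed
    have "subspace (eigenspace A \<theta>)"
      by (auto simp: subspace_def eigenspace_def matrix_vector_right_distrib
          matrix_vector_mult_scaleR scaleR_add_right)
    then show "span (w ` {f. \<mu> f = \<theta>}) \<subseteq> eigenspace A \<theta>"
      by (intro span_minimal) (auto simp: eigenspace_def eig)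
  qed
  moreover have "independent (w ` {f. \<mu> f = \<theta>})"
    using ind by (rule independent_mono) auto
  ultimately show ?thesis
    using card_image[OF inj_on_subset[OF inj subset_UNIV], of "{f. \<mu> f = \<theta>}"]
    by (simp add: dim_span dim_eq_card_independent)
qed

section \<open>The spectrum of a star\<close>

text \<open>
  The vectors taking the value \<open>\<rho>\<close> or \<open>- \<rho>\<close> at the centre \<open>c\<close> and \<open>1\<close> on the leaves belong to the
  eigenvalues \<open>\<rho>\<close> and \<open>- \<rho>\<close>. A vector orthogonal to both vanishes at the centre and has
  sum zero over the leaves, so the star annihilates it. The multiplicities are recorded by
  a generating polynomial because it is multiplicative when eigenvectors are multiplied.
\<close>

lemma star_orthogonal_eigenbasis:
  fixes c :: "'s::finite"
  assumes n: "CARD('s) \<ge> 2"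
  shows "\<exists>(u :: 's \<Rightarrow> real ^ 's) (e :: 's \<Rightarrow> nat).
     (\<forall>a b. a \<noteq> b \<longrightarrow> u a \<bullet> u b = 0) \<and> (\<forall>a. u a \<noteq> 0) \<and>
     (\<forall>a s. (\<Sum>t\<in>UNIV. if (s = c) \<noteq> (t = c) then u a $ t else 0)
        = sqrt (real CARD('s) - 1) * (1 - real (e a)) * u a $ s) \<and>
     (\<Sum>a\<in>UNIV. monom (1::real) (e a)) = [:1, real CARD('s) - 2, 1:]"
proof -
  define \<rho> where "\<rho> = sqrt (real CARD('s) - 1)"
  have \<rho>: "\<rho> > 0" "\<rho> * \<rho> = real CARD('s) - 1" using n by (auto simp: \<rho>_def)
  define p :: "real ^ 's" where "p = (\<chi> s. if s = c then \<rho> else 1)"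
  define q :: "real ^ 's" where "q = (\<chi> s. if s = c then - \<rho> else 1)"
  have rest: "(\<Sum>t\<in>- {c}. f t) = (\<Sum>t\<in>UNIV. f t) - f c" for f :: "'s \<Rightarrow> real"
    by (simp add: Compl_eq_Diff_UNIV sum_diff1)
  have split: "(\<Sum>t\<in>UNIV. f t) = f c + (\<Sum>t\<in>- {c}. f t)" for f :: "'s \<Rightarrow> real"
    by (simp add: rest)
  have cardc: "real (card (- {c})) = real CARD('s) - 1"
    using n by (simp add: Compl_eq_Diff_UNIV card_Diff_singleton of_nat_diff)
  have pv: "p \<bullet> v = \<rho> * v $ c + (\<Sum>t\<in>- {c}. v $ t)" for v
    by (simp add: inner_vec_def split p_def)
  have qv: "q \<bullet> v = - \<rho> * v $ c + (\<Sum>t\<in>- {c}. v $ t)" for v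
    by (simp add: inner_vec_def split q_def)
  have pq: "p \<bullet> q = 0"
    using cardc \<rho> by (simp add: pv q_def)
  have "p $ c \<noteq> q $ c" "p $ c \<noteq> 0" "q $ c \<noteq> 0" using \<rho> by (auto simp: p_def q_def)
  then have ne: "p \<noteq> q" "p \<noteq> 0" "q \<noteq> 0" by auto
  have op: "(\<Sum>t\<in>UNIV. if (s = c) \<noteq> (t = c) then v $ t else 0)
      = (if s = c then \<Sum>t\<in>- {c}. v $ t else v $ c)" for s and v :: "real ^ 's"
    by (simp add: split)
  define W where "W = {v. \<forall>w\<in>{p, q}. orthogonal w v}"
  have subW: "subspace W" unfolding W_def by (rule subspace_orthogonal_to_vectors)
  obtain B where B: "B \<subseteq> W" "pairwise orthogonal B" "\<And>v. v \<in> B \<Longrightarrow> norm v = 1"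
    "independent B" "card B = dim W"
    using orthonormal_basis_subspace[OF subW] by metis
  have "independent {p, q}"
    by (rule pairwise_orthogonal_independent)
       (use ne pq in \<open>auto simp: pairwise_def orthogonal_def inner_commute\<close>)
  then have "dim {p, q} = 2" using ne by (simp add: dim_eq_card_independent)
  moreover have "W = {v \<in> UNIV. \<forall>w\<in>span {p, q}. orthogonal w v}"
    unfolding W_def by (auto intro: span_base orthogonal_to_span simp: orthogonal_commute)
  then have "dim W + dim (span {p, q}) = dim (UNIV :: (real ^ 's) set)"
    using dim_subspace_orthogonal_to_vectors[of "span {p, q}" "UNIV :: (real ^ 's) set"] by simp
  ultimately have cardB: "card B + 2 = CARD('s)" using B(5) by simp
  have finB: "finite B" using B(4) by (rule independent_imp_finite)
  have BW: "p \<bullet> v = 0" "q \<bullet> v = 0" "v \<noteq> 0" if "v \<in> B" for v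
    using B(1) B(3)[OF that] that by (auto simp: W_def orthogonal_def)
  have notB: "p \<notin> B" "q \<notin> B" using BW ne by (metis inner_eq_zero_iff)+
  define C where "C = insert p (insert q B)"
  have "finite C" "card C = CARD('s)"
    using finB notB ne cardB by (auto simp: C_def)
  then obtain u where u: "bij_betw u (UNIV :: 's set) C"
    using finite_same_card_bij[of "UNIV :: 's set" C] by auto
  have uC: "u a \<in> C" for a using u by (auto simp: bij_betw_def)
  have orthC: "v \<bullet> w = 0" if "v \<in> C" "w \<in> C" "v \<noteq> w" for v w
    using that B(2) BW pq inner_commute[of v w] inner_commute[of p q]
    by (auto simp: C_def pairwise_def orthogonal_def)
  define e where "e v = (if v = p then 0 else if v = q then 2 else 1 :: nat)" for v
  have eig: "(\<Sum>t\<in>UNIV. if (s = c) \<noteq> (t = c) then v $ t else 0) = \<rho> * (1 - real (e v)) * v $ s"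
    if v: "v \<in> C" for v s
  proof -
    consider "v = p" | "v = q" | "v \<in> B" "v \<noteq> p" "v \<noteq> q"
      using v notB by (auto simp: C_def)
    then show ?thesis
    proof cases
      case 1
      then show ?thesis unfolding op using cardc \<rho> by (simp add: e_def p_def)
    next
      case 2
      then show ?thesis unfolding op using cardc \<rho> ne by (simp add: e_def q_def)
    next
      case 3
      have "v $ c = 0 \<and> (\<Sum>t\<in>- {c}. v $ t) = 0"
        using BW(1,2)[OF 3(1)] \<rho>(1) unfolding pv qv by auto
      then show ?thesis unfolding op using 3 by (simp add: e_def)
    qed
  qed
  have "(\<Sum>a\<in>UNIV. monom (1::real) (e (u a))) = (\<Sum>v\<in>C. monom 1 (e v))"
    by (rule sum.reindex_bij_betw[OF u])
  also have "\<dots> = monom 1 0 + (monom 1 2 + (\<Sum>v\<in>B. monom 1 (e v)))"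
    unfolding C_def using finB notB ne by (simp add: e_def)
  also have "(\<Sum>v\<in>B. monom (1::real) (e v)) = (\<Sum>v\<in>B. monom 1 1)"
    by (intro sum.cong refl) (use notB in \<open>auto simp: e_def\<close>)
  also have "monom 1 0 + (monom 1 2 + \<dots>) = [:1, real CARD('s) - 2, 1:]"
    by (simp add: monom_altdef of_nat_poly numeral_2_eq_2 flip: cardB)
  finally have gen: "(\<Sum>a\<in>UNIV. monom (1::real) (e (u a))) = [:1, real CARD('s) - 2, 1:]" .
  show ?thesis
  proof (intro exI[of _ u] exI[of _ "\<lambda>a. e (u a)"] conjI allI impI gen)
    fix a b :: 's assume "a \<noteq> b"
    then show "u a \<bullet> u b = 0"
      using u by (intro orthC uC) (auto simp: bij_betw_def inj_on_def)
  next
    fix a show "u a \<noteq> 0" using uC[of a] ne BW(3) by (auto simp: C_def)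
  qed (use eig[OF uC] in \<open>auto simp: \<rho>_def\<close>)
qed

section \<open>The full bipartite graph as a product of stars\<close>

lemma hamming_edge_iff:
  "{y, z} \<in> hamming_edges \<longleftrightarrow> card {k. y $ k \<noteq> z $ k} = 1"
proof -
  have "{k. y $ k \<noteq> z $ k} = {k. z $ k \<noteq> y $ k}" by auto
  then show ?thesis by (auto simp: hamming_edges_def doubleton_eq_iff)
qed

text \<open>
  A step changes the number of differing coordinates by at most one, and correcting the differing
  coordinates one at a time gives a walk of exactly that length.
\<close>

lemma graph_dist_hamming:
  fixes x y :: "'s ^ 'd::finite"
  shows "graph_dist hamming_edges x y = card {k. x $ k \<noteq> y $ k}"
proof -
  let ?R = "{(a, b). {a, b} \<in> (hamming_edges :: ('s ^ 'd) set set)}"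
  let ?h = "\<lambda>a b :: 's ^ 'd. card {k. a $ k \<noteq> b $ k}"
  have edge: "(a, b) \<in> ?R \<longleftrightarrow> ?h a b = 1" for a b
    by (simp add: hamming_edge_iff)
  have lower: "(a, b) \<in> ?R ^^ m \<Longrightarrow> ?h a b \<le> m" for a b m
  proof (induction m arbitrary: b)
    case (Suc m)
    then obtain b' where b': "(a, b') \<in> ?R ^^ m" "(b', b) \<in> ?R" by auto
    have "?h a b \<le> card ({k. a $ k \<noteq> b' $ k} \<union> {k. b' $ k \<noteq> b $ k})"
      by (rule card_mono) auto
    also have "\<dots> \<le> ?h a b' + ?h b' b" by (rule card_Un_le)
    also have "\<dots> \<le> m + 1" using Suc.IH[OF b'(1)] b'(2) unfolding edge by simp
    finally show ?case by simp
  qed auto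
  have upper: "?h a b = m \<Longrightarrow> (a, b) \<in> ?R ^^ m" for a b m
  proof (induction m arbitrary: b)
    case 0
    then show ?case by (auto simp: vec_eq_iff)
  next
    case (Suc m)
    then obtain k where k: "a $ k \<noteq> b $ k"
      by (metis (mono_tags, lifting) card.empty empty_Collect_eq nat.distinct(1))
    define b' where "b' = (\<chi> l. if l = k then a $ k else b $ l)"
    have "{l. a $ l \<noteq> b' $ l} = {l. a $ l \<noteq> b $ l} - {k}" by (auto simp: b'_def)
    then have "?h a b' = m" using Suc.prems k by (simp add: card_Diff_singleton)
    moreover have "{l. b' $ l \<noteq> b $ l} = {k}" using k by (auto simp: b'_def)
    then have "(b', b) \<in> ?R" unfolding edge by simp
    ultimately show ?case using Suc.IH by auto
  qed
  show ?thesis unfolding graph_dist_def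
    by (rule Least_equality) (use lower upper in auto)
qed

text \<open>
  If \<open>y\<close> and \<open>z\<close> differ only at \<open>k\<close>, then their distances to \<open>x\<close> differ iff coordinate \<open>k\<close> counts
  towards exactly one of the two.
\<close>

lemma full_bipartite_hamming_edge_iff:
  fixes x y z :: "'s ^ 'd::finite"
  shows "{y, z} \<in> full_bipartite_edges hamming_edges x \<longleftrightarrow>
    (\<exists>k. (y $ k = x $ k) \<noteq> (z $ k = x $ k) \<and> (\<forall>l. l \<noteq> k \<longrightarrow> z $ l = y $ l))"
proof -
  let ?h = "\<lambda>a b :: 's ^ 'd. card {k. a $ k \<noteq> b $ k}"
  have "{y, z} \<in> full_bipartite_edges hamming_edges x \<longleftrightarrow> ?h y z = 1 \<and> ?h x y \<noteq> ?h x z"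
    by (auto simp: full_bipartite_edges_def hamming_edge_iff doubleton_eq_iff graph_dist_hamming)
  also have "\<dots> \<longleftrightarrow> (\<exists>k. {l. y $ l \<noteq> z $ l} = {k} \<and> (y $ k = x $ k) \<noteq> (z $ k = x $ k))"
  proof -
    have "?h x y \<noteq> ?h x z \<longleftrightarrow> (y $ k = x $ k) \<noteq> (z $ k = x $ k)"
      if yz: "{l. y $ l \<noteq> z $ l} = {k}" for k
    proof -
      have yz': "z $ l = y $ l" if "l \<noteq> k" for l
      proof -
        have "l \<notin> {l. y $ l \<noteq> z $ l}" using that unfolding yz by simp
        then show ?thesis by simp
      qed
      define N where "N = {l. l \<noteq> k \<and> x $ l \<noteq> y $ l}"
      have hd: "?h x w = (if w $ k = x $ k then card N else Suc (card N))"
        if w: "\<And>l. l \<noteq> k \<Longrightarrow> w $ l = y $ l" for w :: "'s ^ 'd"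
      proof -
        have "{l. x $ l \<noteq> w $ l} = (if w $ k = x $ k then N else insert k N)"
        proof (rule set_eqI)
          fix l
          show "l \<in> {l. x $ l \<noteq> w $ l} \<longleftrightarrow> l \<in> (if w $ k = x $ k then N else insert k N)"
          proof (cases "l = k")
            case True
            have "(x $ k \<noteq> w $ k) = (w $ k \<noteq> x $ k)" by (simp only: eq_commute)
            then show ?thesis by (simp add: True N_def)
          next
            case False
            then show ?thesis using w[of l] by (simp add: N_def)
          qed
        qed
        then show ?thesis by (simp add: N_def)
      qed
      show ?thesis using hd[of y] hd[of z] yz' by (simp split: if_splits)
    qed
    then show ?thesis unfolding One_nat_def card_1_singleton_iff by blast
  qed
  also have "\<dots> \<longleftrightarrow> (\<exists>k. (y $ k = x $ k) \<noteq> (z $ k = x $ k) \<and> (\<forall>l. l \<noteq> k \<longrightarrow> z $ l = y $ l))"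
  proof (intro ex_cong1)
    fix k
    have "{l. y $ l \<noteq> z $ l} = {k} \<longleftrightarrow> y $ k \<noteq> z $ k \<and> (\<forall>l. l \<noteq> k \<longrightarrow> z $ l = y $ l)"
      unfolding set_eq_iff mem_Collect_eq singleton_iff by (metis (no_types))
    moreover have "(y $ k = x $ k) = (z $ k = x $ k)" if "y $ k = z $ k" by (simp only: that)
    ultimately show "{l. y $ l \<noteq> z $ l} = {k} \<and> (y $ k = x $ k) \<noteq> (z $ k = x $ k) \<longleftrightarrow>
        (y $ k = x $ k) \<noteq> (z $ k = x $ k) \<and> (\<forall>l. l \<noteq> k \<longrightarrow> z $ l = y $ l)"
      by blast
  qed
  finally show ?thesis .
qed

text \<open>
  The adjacency matrix is the sum over the coordinates of star operators acting on one coordinate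
  each. The sum over neighbours splits this way because a neighbour determines both the coordinate in
  which it differs and its new entry there.
\<close>

lemma full_bipartite_hamming_matrix_vector:
  fixes x y :: "'s::finite ^ 'd::finite"
  shows "(adjacency_matrix (full_bipartite_edges hamming_edges x) *v v) $ y
    = (\<Sum>k\<in>UNIV. \<Sum>t\<in>UNIV.
        if (y $ k = x $ k) \<noteq> (t = x $ k) then v $ (\<chi> l. if l = k then t else y $ l) else 0)"
proof -
  let ?E = "full_bipartite_edges hamming_edges x"
  define N where "N = (SIGMA k:UNIV. {t. (y $ k = x $ k) \<noteq> (t = x $ k)})"
  define g where "g = (\<lambda>(k, t). (\<chi> l. if l = k then t else y $ l) :: 's ^ 'd)"
  have gk: "g (k, t) $ l = (if l = k then t else y $ l)" for k t l by (simp add: g_def)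
  have "inj_on g N"
  proof (rule inj_onI)
    fix a b assume a: "a \<in> N" and b: "b \<in> N" and eq: "g a = g b"
    obtain k t k' t' where ab: "a = (k, t)" "b = (k', t')" by (metis surj_pair)
    have "t \<noteq> y $ k" using a by (auto simp: ab N_def)
    then have "k = k'" using eq gk unfolding ab by metis
    then show "a = b" using eq gk unfolding ab by metis
  qed
  moreover have "g ` N = {z. {y, z} \<in> ?E}"
  proof (intro equalityI subsetI)
    fix z assume "z \<in> {z. {y, z} \<in> ?E}"
    then obtain k where k: "(y $ k = x $ k) \<noteq> (z $ k = x $ k)" "\<forall>l. l \<noteq> k \<longrightarrow> z $ l = y $ l"
      unfolding full_bipartite_hamming_edge_iff by auto
    then have "z = g (k, z $ k)" by (simp add: vec_eq_iff gk)
    then show "z \<in> g ` N" using k(1) by (auto simp: N_def)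
  qed (auto simp: full_bipartite_hamming_edge_iff N_def gk)
  ultimately have bij: "bij_betw g N {z. {y, z} \<in> ?E}" by (simp add: bij_betw_def)
  have "(adjacency_matrix ?E *v v) $ y = (\<Sum>z\<in>UNIV. if {y, z} \<in> ?E then v $ z else 0)"
    by (simp add: matrix_vector_mult_def adjacency_matrix_def if_distrib[of "\<lambda>a. a * _"] cong: if_cong)
  also have "\<dots> = (\<Sum>z\<in>{z. {y, z} \<in> ?E}. v $ z)"
    by (simp add: sum.If_cases)
  also have "\<dots> = (\<Sum>a\<in>N. v $ g a)"
    by (rule sum.reindex_bij_betw[OF bij, symmetric])
  also have "\<dots> = (\<Sum>k\<in>UNIV. \<Sum>t\<in>{t. (y $ k = x $ k) \<noteq> (t = x $ k)}. v $ g (k, t))"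
    unfolding N_def by (simp add: sum.Sigma)
  also have "\<dots> = (\<Sum>k\<in>UNIV. \<Sum>t\<in>UNIV. if (y $ k = x $ k) \<noteq> (t = x $ k) then v $ g (k, t) else 0)"
    by (simp add: sum.If_cases)
  finally show ?thesis by (simp only: g_def prod.case)
qed

section \<open>Multiplicities as trinomial coefficients\<close>

text \<open>
  This distributive law turns both inner products of product vectors and the generating
  polynomial of the product graph into products over the coordinates.
\<close>

lemma sum_vec_prod:
  fixes h :: "'d::finite \<Rightarrow> 's::finite \<Rightarrow> 'a::comm_semiring_1"
  shows "(\<Sum>y\<in>(UNIV :: ('s ^ 'd) set). \<Prod>k\<in>UNIV. h k (y $ k)) = (\<Prod>k\<in>UNIV. \<Sum>a\<in>UNIV. h k a)"
proof -
  have "(\<Prod>k\<in>UNIV. \<Sum>a\<in>UNIV. h k a) = (\<Sum>g\<in>PiE UNIV (\<lambda>_. UNIV). \<Prod>k\<in>UNIV. h k (g k))"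
    by (rule prod_sum_PiE) auto
  also have "\<dots> = (\<Sum>y\<in>(UNIV :: ('s ^ 'd) set). \<Prod>k\<in>UNIV. h k (y $ k))"
    by (rule sum.reindex_bij_witness[of _ "vec_nth" "vec_lambda"]) (auto simp: PiE_def)
  finally show ?thesis by simp
qed

lemma monom_sum_prod:
  "monom 1 (\<Sum>k\<in>K. e k) = (\<Prod>k\<in>K. monom (1 :: 'a::comm_semiring_1) (e k))"
proof (induction K rule: infinite_finite_induct)
  case (insert k K)
  then show ?case using mult_monom[of "1 :: 'a" "e k" 1 "sum e K"] by simp
qed simp_all

text \<open>
  The product vectors \<open>U f\<close> are indexed by the vertices \<open>f\<close>: the entry \<open>f $ k\<close> selects an eigenvector
  of the star of coordinate \<open>k\<close>. Since \<open>\<rho> \<noteq> 0\<close>, the eigenvalue of \<open>U f\<close> determines the sum of the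
  exponents, and so the multiplicity counts the \<open>f\<close> whose exponents add up to \<open>i\<close>.
\<close>

lemma multiplicity_eq_coeff:
  fixes x :: "'s::finite ^ 'd::finite"
  assumes n: "CARD('s) \<ge> 2"
  shows "real (multiplicity_of (adjacency_matrix (full_bipartite_edges hamming_edges x))
      (sqrt (real CARD('s) - 1) * (real CARD('d) - real i)))
    = coeff ([:1, real CARD('s) - 2, 1:] ^ CARD('d)) i"
proof -
  define \<rho> where "\<rho> = sqrt (real CARD('s) - 1)"
  have \<rho>: "\<rho> > 0" using n by (simp add: \<rho>_def)
  define A where "A = adjacency_matrix (full_bipartite_edges hamming_edges x)"
  have "\<forall>k. \<exists>(u :: 's \<Rightarrow> real ^ 's) (e :: 's \<Rightarrow> nat).
     (\<forall>a b. a \<noteq> b \<longrightarrow> u a \<bullet> u b = 0) \<and> (\<forall>a. u a \<noteq> 0) \<and>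
     (\<forall>a s. (\<Sum>t\<in>UNIV. if (s = x $ k) \<noteq> (t = x $ k) then u a $ t else 0)
        = \<rho> * (1 - real (e a)) * u a $ s) \<and>
     (\<Sum>a\<in>UNIV. monom (1::real) (e a)) = [:1, real CARD('s) - 2, 1:]"
    unfolding \<rho>_def using star_orthogonal_eigenbasis[OF n] by blast
  then obtain u :: "'d \<Rightarrow> 's \<Rightarrow> real ^ 's" and e :: "'d \<Rightarrow> 's \<Rightarrow> nat" where
    orth: "\<And>k a b. a \<noteq> b \<Longrightarrow> u k a \<bullet> u k b = 0" and nz: "\<And>k a. u k a \<noteq> 0" and
    eig: "\<And>k a s. (\<Sum>t\<in>UNIV. if (s = x $ k) \<noteq> (t = x $ k) then u k a $ t else 0)
        = \<rho> * (1 - real (e k a)) * u k a $ s" and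
    gen: "\<And>k. (\<Sum>a\<in>UNIV. monom (1::real) (e k a)) = [:1, real CARD('s) - 2, 1:]"
    unfolding choice_iff by blast
  define U :: "'s ^ 'd \<Rightarrow> real ^ ('s ^ 'd)" where
    "U f = (\<chi> y. \<Prod>k\<in>UNIV. u k (f $ k) $ (y $ k))" for f
  have inner: "U f \<bullet> U g = (\<Prod>k\<in>UNIV. u k (f $ k) \<bullet> u k (g $ k))" for f g
    using sum_vec_prod[of "\<lambda>k a. u k (f $ k) $ a * u k (g $ k) $ a"]
    by (simp add: inner_vec_def U_def prod.distrib)
  have deg: "\<rho> * (real CARD('d) - real (\<Sum>k\<in>UNIV. e k (f $ k)))
      = (\<Sum>k\<in>UNIV. \<rho> * (1 - real (e k (f $ k))))" for f :: "'s ^ 'd"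
    by (simp add: sum_subtractf flip: sum_distrib_left)
  have "A *v U f = (\<rho> * (real CARD('d) - real (\<Sum>k\<in>UNIV. e k (f $ k)))) *\<^sub>R U f" for f
  proof (subst vec_eq_iff, rule allI)
    fix y
    have upd: "U f $ (\<chi> l. if l = k then t else y $ l)
        = u k (f $ k) $ t * (\<Prod>l\<in>UNIV - {k}. u l (f $ l) $ (y $ l))" for k t
      by (simp add: U_def prod.remove[of UNIV k])
    have "(A *v U f) $ y = (\<Sum>k\<in>UNIV. \<Sum>t\<in>UNIV. if (y $ k = x $ k) \<noteq> (t = x $ k)
        then u k (f $ k) $ t * (\<Prod>l\<in>UNIV - {k}. u l (f $ l) $ (y $ l)) else 0)"
      unfolding A_def full_bipartite_hamming_matrix_vector upd ..
    also have "\<dots> = (\<Sum>k\<in>UNIV. (\<Sum>t\<in>UNIV. if (y $ k = x $ k) \<noteq> (t = x $ k)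
        then u k (f $ k) $ t else 0) * (\<Prod>l\<in>UNIV - {k}. u l (f $ l) $ (y $ l)))"
      unfolding sum_distrib_right by (intro sum.cong refl) auto
    also have "\<dots> = (\<Sum>k\<in>UNIV. \<rho> * (1 - real (e k (f $ k))) *
        (u k (f $ k) $ (y $ k) * (\<Prod>l\<in>UNIV - {k}. u l (f $ l) $ (y $ l))))"
      unfolding eig by (simp add: mult.assoc)
    also have "\<dots> = (\<Sum>k\<in>UNIV. \<rho> * (1 - real (e k (f $ k))) * U f $ y)"
    proof (intro sum.cong refl)
      fix k :: 'd
      show "\<rho> * (1 - real (e k (f $ k))) *
          (u k (f $ k) $ (y $ k) * (\<Prod>l\<in>UNIV - {k}. u l (f $ l) $ (y $ l)))
        = \<rho> * (1 - real (e k (f $ k))) * U f $ y"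
        by (simp add: U_def prod.remove[of UNIV k])
    qed
    finally show "(A *v U f) $ y
        = ((\<rho> * (real CARD('d) - real (\<Sum>k\<in>UNIV. e k (f $ k)))) *\<^sub>R U f) $ y"
      unfolding deg by (simp add: sum_distrib_right)
  qed
  moreover have "U f \<bullet> U g = 0" if fg: "f \<noteq> g" for f g
  proof -
    obtain k where "f $ k \<noteq> g $ k" using fg by (metis vec_eq_iff)
    then show ?thesis unfolding inner by (intro prod_zero) (auto intro: orth)
  qed
  moreover have "U f \<noteq> 0" for f
  proof -
    have "U f \<bullet> U f \<noteq> 0" unfolding inner by (simp add: nz)
    then show ?thesis by auto
  qed
  ultimately have "dim (eigenspace A (\<rho> * (real CARD('d) - real i)))
      = card {f. \<rho> * (real CARD('d) - real (\<Sum>k\<in>UNIV. e k (f $ k))) = \<rho> * (real CARD('d) - real i)}"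
    by (intro dim_eigenspace_orthogonal_eigenbasis[of U])
  also have "\<dots> = card {f :: 's ^ 'd. (\<Sum>k\<in>UNIV. e k (f $ k)) = i}"
    using \<rho> by (simp del: of_nat_sum)
  also have "real \<dots> = (\<Sum>f\<in>(UNIV :: ('s ^ 'd) set). coeff (monom 1 (\<Sum>k\<in>UNIV. e k (f $ k))) i)"
    by (simp add: sum.If_cases)
  also have "\<dots> = coeff (\<Sum>f\<in>(UNIV :: ('s ^ 'd) set). \<Prod>k\<in>UNIV. monom 1 (e k (f $ k))) i"
    by (simp add: coeff_sum monom_sum_prod)
  also have "\<dots> = coeff ([:1, real CARD('s) - 2, 1:] ^ CARD('d)) i"
    using sum_vec_prod[of "\<lambda>k a. monom (1::real) (e k a)"] by (simp add: gen)
  finally show ?thesis by (simp add: multiplicity_of_def A_def \<rho>_def)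
qed

section \<open>Trinomial coefficients and ballot numbers\<close>

text \<open>
  Take the middle term \<open>m * t\<close> from \<open>c\<close> of the \<open>D\<close> factors and expand \<open>(1 + t\<^sup>2) ^ (D - c)\<close>: taking \<open>t\<^sup>2\<close>
  from \<open>b\<close> of the remaining factors gives \<open>t ^ i\<close> iff \<open>c + 2 * b = i\<close>.
\<close>

lemma coeff_trinomial_power:
  fixes m :: real
  shows "coeff ([:1, m, 1:] ^ D) i
    = (\<Sum>c | c \<le> D \<and> c \<le> i \<and> even (i - c).
        real (D choose c) * m ^ c * real ((D - c) choose ((i - c) div 2)))"
proof -
  have square: "[:1, 0, 1 :: real:] ^ e = (\<Sum>b\<le>e. monom (real (e choose b)) (2 * b))" for e
  proof -
    have "[:1, 0, 1 :: real:] = monom 1 2 + 1" by (simp add: monom_altdef numeral_2_eq_2 one_pCons)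
    then show ?thesis
      by (simp add: binomial_ring monom_power of_nat_poly mult_monom monom_0 [symmetric]
          smult_monom mult.commute)
  qed
  have "[:1, m, 1:] = monom m 1 + [:1, 0, 1:]" by (simp add: monom_altdef)
  then have "[:1, m, 1:] ^ D = (\<Sum>c\<le>D. monom (real (D choose c) * m ^ c) c * [:1, 0, 1:] ^ (D - c))"
    by (simp add: binomial_ring monom_power of_nat_poly mult_monom smult_monom)
  then have "coeff ([:1, m, 1:] ^ D) i
      = (\<Sum>c\<le>D. \<Sum>b\<le>D - c. coeff (monom (real (D choose c) * m ^ c * real ((D - c) choose b)) (c + 2 * b)) i)"
    by (simp add: square sum_distrib_left mult_monom coeff_sum)
  also have "\<dots> = (\<Sum>c\<le>D. if c \<le> i \<and> even (i - c)
      then real (D choose c) * m ^ c * real ((D - c) choose ((i - c) div 2)) else 0)"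
  proof (rule sum.cong[OF refl])
    fix c
    let ?t = "\<lambda>b. real (D choose c) * m ^ c * real ((D - c) choose b)"
    have "(\<Sum>b\<le>D - c. coeff (monom (?t b) (c + 2 * b)) i)
        = (\<Sum>b\<le>D - c. if c \<le> i \<and> even (i - c) \<and> b = (i - c) div 2 then ?t b else 0)"
      by (intro sum.cong refl) (auto simp: le_iff_add)
    also have "\<dots> = (if c \<le> i \<and> even (i - c) then ?t ((i - c) div 2) else 0)"
      by (auto simp: sum.delta not_le binomial_eq_0)
    finally show "(\<Sum>b\<le>D - c. coeff (monom (?t b) (c + 2 * b)) i)
        = (if c \<le> i \<and> even (i - c) then ?t ((i - c) div 2) else 0)" .
  qed
  also have "\<dots> = (\<Sum>c | c \<le> D \<and> c \<le> i \<and> even (i - c).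
        real (D choose c) * m ^ c * real ((D - c) choose ((i - c) div 2)))"
    by (simp add: sum.If_cases, intro sum.cong) auto
  finally show ?thesis .
qed

text \<open>
  The summand is \<open>(e choose j) - (e choose (j - 1))\<close>, so the sum telescopes. The hypothesis keeps
  the denominators positive.
\<close>

lemma sum_ballot_numbers:
  assumes "2 * J \<le> e"
  shows "(\<Sum>j\<le>J. (real e - 2 * real j + 1) / (real e - real j + 1) * real (e choose j)) = real (e choose J)"
  using assms
proof (induction J)
  case (Suc J)
  have "Suc J * (e choose Suc J) = (e - J) * (e choose J)"
    using Suc.prems binomial_absorption[of J e] binomial_absorb_comp[of e J] by simp
  then have "(real J + 1) * real (e choose Suc J) = (real e - real J) * real (e choose J)"
    using Suc.prems by (simp flip: of_nat_mult of_nat_Suc of_nat_diff add: add.commute)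
  moreover have "real e - real J > 0" using Suc.prems by simp
  ultimately have "real (e choose J) = (real J + 1) / (real e - real J) * real (e choose Suc J)"
    by (simp add: field_simps)
  moreover have "(real J + 1) / (real e - real J) + (real e - 2 * real (Suc J) + 1) / (real e - real (Suc J) + 1) = 1"
  proof -
    have den: "real e - real (Suc J) + 1 = real e - real J" by simp
    show ?thesis
      using \<open>real e - real J > 0\<close> unfolding den by (simp flip: add_divide_distrib)
  qed
  ultimately have "real (e choose J) + (real e - 2 * real (Suc J) + 1) / (real e - real (Suc J) + 1)
      * real (e choose Suc J) = real (e choose Suc J)"
    by (simp only: distrib_right[symmetric] mult_1)
  moreover have "2 * J \<le> e" using Suc.prems by simp
  ultimately show ?case using Suc.IH by (simp only: sum.atMost_Suc)
qed simp

text \<open>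
  The substitution \<open>c = 2 * r + d - D\<close>, \<open>j = D - r - d\<close> has the inverse \<open>d = D - c - 2 * j\<close>, \<open>r = c + j\<close>.
  With \<open>a = \<bar>D - i\<bar>\<close>, the constraint \<open>a \<le> d\<close> becomes \<open>j \<le> (D - c - a) div 2\<close>, and the parity condition
  on \<open>d\<close> becomes one on \<open>c\<close> alone, so that \<open>j\<close> runs over a full initial segment and the ballot numbers
  can be summed.
\<close>

lemma mult_rd_sum_eq:
  assumes i: "i \<le> 2 * D"
  shows "(\<Sum>d \<in> {d::int. \<bar>int D - int i\<bar> \<le> d \<and> d \<le> int D \<and> even (d - int D + int i)}.
              \<Sum>r \<in> {r::int. 0 \<le> r \<and> r \<le> int D - d}. mult_rd D n r d)
    = (\<Sum>c | c \<le> D \<and> c \<le> i \<and> even (i - c).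
        real (D choose c) * (real n - 2) ^ c * real ((D - c) choose ((i - c) div 2)))"
    (is "(\<Sum>d \<in> ?\<D>. \<Sum>r \<in> ?R d. _) = _")
proof -
  define a where "a = nat \<bar>int D - int i\<bar>"
  define C where "C = {c. a + c \<le> D \<and> even (i + c)}"
  define J where "J c = (D - c - a) div 2" for c
  let ?w = "\<lambda>c. real (D choose c) * (real n - 2) ^ c"
  let ?b = "\<lambda>e j. (real e - 2 * real j + 1) / (real e - real j + 1) * real (e choose j)"
  have ia: "int a = \<bar>int D - int i\<bar>" by (simp add: a_def)
  have finD: "finite ?\<D>" by (rule finite_subset[of _ "{0..int D}"]) auto
  have finR: "finite (?R d)" for d by (rule finite_subset[of _ "{0..int D - d}"]) auto
  have par: "even (a + c + D) \<longleftrightarrow> even (i + c)" for c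
  proof -
    have "even (int a + int c + int D) \<longleftrightarrow> even (int i + int c)" unfolding ia by auto
    then show ?thesis by (simp flip: of_nat_add)
  qed
  have finC: "finite C" by (rule finite_subset[of _ "{..D}"]) (auto simp: C_def)
  define P where "P = Sigma ?\<D> ?R"
  have finP: "finite P" unfolding P_def using finD finR by (intro finite_SigmaI)
  have "(\<Sum>d \<in> ?\<D>. \<Sum>r \<in> ?R d. mult_rd D n r d) = (\<Sum>(d, r) \<in> P. mult_rd D n r d)"
    unfolding P_def using finD finR by (intro sum.Sigma) auto
  also have "\<dots> = (\<Sum>(d, r) \<in> {(d, r) \<in> P. int D \<le> 2 * r + d}. mult_rd D n r d)"
    using finP by (intro sum.mono_neutral_right) (auto simp: mult_rd_def split: if_splits)
  also have "\<dots> = (\<Sum>(c, j) \<in> (SIGMA c:C. {..J c}). ?w c * ?b (D - c) j)"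
  proof (rule sum.reindex_bij_witness[of _
        "\<lambda>(c, j). (int D - int c - 2 * int j, int c + int j)"
        "\<lambda>(d, r). (nat (2 * r + d - int D), nat (int D - r - d))"], goal_cases)
    case (1 p)
    then show ?case by (auto simp: P_def)
  next
    case (2 p)
    then obtain d r where p: "p = (d, r)" "\<bar>int D - int i\<bar> \<le> d" "d \<le> int D" "even (d - int D + int i)"
      "0 \<le> r" "r \<le> int D - d" "int D \<le> 2 * r + d" by (auto simp: P_def)
    have "a + nat (2 * r + d - int D) \<le> D" using p ia by linarith
    moreover have "even (int i + (2 * r + d - int D))" using p(4) by presburger
    then have "even (int (i + nat (2 * r + d - int D)))" using p by simp
    then have "even (i + nat (2 * r + d - int D))" by presburger
    moreover have "nat (int D - r - d) \<le> J (nat (2 * r + d - int D))"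
      unfolding J_def using p ia by linarith
    ultimately show ?case by (simp add: p(1) C_def)
  next
    case (3 q)
    then show ?case by auto
  next
    case (4 q)
    then obtain c j where q: "q = (c, j)" "a + c \<le> D" "even (i + c)" "j \<le> J c"
      by (auto simp: C_def)
    have "a + c + 2 * j \<le> D" using q unfolding J_def by linarith
    moreover have "even (int D - int c - 2 * int j - int D + int i)" using q(3) by presburger
    ultimately show ?case using ia by (auto simp add: q(1) P_def)
  next
    case (5 p)
    then obtain d r where p: "p = (d, r)" "\<bar>int D - int i\<bar> \<le> d" "0 \<le> r" "r \<le> int D - d" "int D \<le> 2 * r + d"
      by (auto simp: P_def)
    define c where "c = nat (2 * r + d - int D)"
    define j where "j = nat (int D - r - d)"
    have dr: "r = int c + int j" "d = int D - int c - 2 * int j" and "c + 2 * j \<le> D"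
      using p unfolding c_def j_def by linarith+
    moreover have "nat (2 * int D - 2 * r - d) = D - c" using dr \<open>c + 2 * j \<le> D\<close> by linarith
    ultimately have "mult_rd D n r d = ?w c * ?b (D - c) j"
      using p by (simp add: mult_rd_def of_nat_diff binomial_symmetric[of c D] diff_diff_eq mult_ac
          flip: c_def j_def)
    then show ?case by (simp add: p(1) c_def j_def)
  qed
  also have "\<dots> = (\<Sum>c\<in>C. \<Sum>j\<le>J c. ?w c * ?b (D - c) j)"
    using finC by (intro sum.Sigma[symmetric]) auto
  also have "\<dots> = (\<Sum>c\<in>C. ?w c * real ((D - c) choose ((i - c) div 2)))"
  proof (rule sum.cong[OF refl])
    fix c assume "c \<in> C"
    then have c: "a + c \<le> D" "even (i + c)" by (auto simp: C_def)
    have "2 * J c \<le> D - c" by (simp add: J_def)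
    then have "(\<Sum>j\<le>J c. ?w c * ?b (D - c) j) = ?w c * real ((D - c) choose J c)"
      by (simp only: sum_distrib_left[symmetric] sum_ballot_numbers)
    also have "(D - c) choose J c = (D - c) choose ((i - c) div 2)"
    \<comment> \<open>For \<open>i \<le> D\<close> the two lower indices agree; for \<open>i > D\<close> they add up to \<open>D - c\<close>.\<close>
    proof (cases "i \<le> D")
      case True
      then have "J c = (i - c) div 2" using ia c unfolding J_def by auto
      then show ?thesis by simp
    next
      case False
      have "c \<le> i" using False c by simp
      then obtain k where k: "i = c + 2 * k"
        using c(2) by (metis even_add evenE le_iff_add)
      have "D - c - a = 2 * (D - c - k)" "k \<le> D - c" using ia c i False k by linarith+
      then have "J c = D - c - (i - c) div 2" "(i - c) div 2 \<le> D - c"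
        using k by (simp_all add: J_def)
      then show ?thesis by (simp add: binomial_symmetric)
    qed
    finally show "(\<Sum>j\<le>J c. ?w c * ?b (D - c) j) = ?w c * real ((D - c) choose ((i - c) div 2))" .
  qed
  also have "\<dots> = (\<Sum>c | c \<le> D \<and> c \<le> i \<and> even (i - c). ?w c * real ((D - c) choose ((i - c) div 2)))"
  proof (rule sum.mono_neutral_left)
    show "C \<subseteq> {c. c \<le> D \<and> c \<le> i \<and> even (i - c)}"
      using ia by (auto simp: C_def)
    show "\<forall>c\<in>{c. c \<le> D \<and> c \<le> i \<and> even (i - c)} - C. ?w c * real ((D - c) choose ((i - c) div 2)) = 0"
    proof
      fix c assume "c \<in> {c. c \<le> D \<and> c \<le> i \<and> even (i - c)} - C"
      then have c: "c \<le> D" "c \<le> i" "even (i - c)" "D < a + c" by (auto simp: C_def)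
      \<comment> \<open>Here \<open>c \<le> i\<close> rules out \<open>i \<le> D\<close>, and for \<open>i > D\<close> the lower index is too large.\<close>
      then have "2 * D < i + c" using ia by linarith
      moreover obtain k where "i - c = 2 * k" using c(3) by (rule evenE)
      ultimately have "D - c < (i - c) div 2" using c by simp
      then show "?w c * real ((D - c) choose ((i - c) div 2)) = 0" by (simp add: binomial_eq_0)
    qed
  qed simp
  finally show ?thesis .
qed

section \<open>The multiplicity formula\<close>

theorem proposition6p4:
  fixes x :: "('s::finite) ^ ('d::finite)" and D n i :: nat
  assumes "CARD('d) = D" and "CARD('s) = n"
    and "D \<ge> 3" and "n \<ge> 3"
    and "i \<le> 2 * D"
  shows "real (multiplicity_of
            (adjacency_matrix (full_bipartite_edges hamming_edges x))
            (sqrt (real n - 1) * (real D - real i)))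
         = (\<Sum>d \<in> {d::int. \<bar>int D - int i\<bar> \<le> d \<and> d \<le> int D \<and> even (d - int D + int i)}.
              \<Sum>r \<in> {r::int. 0 \<le> r \<and> r \<le> int D - d}. mult_rd D n r d)"
proof -
  have "CARD('s) \<ge> 2" using assms by simp
  from multiplicity_eq_coeff[OF this, of x i] show ?thesis
    unfolding mult_rd_sum_eq[OF assms(5)] coeff_trinomial_power assms(1,2) .
qed

end
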